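(* Let $1\le p<+\infty$. There exist two frequently hypercyclic weighted shifts $B_w$ and $B_{w'}$ on $\ell^p$ such that the sequence $\Big(\frac{\prod_{k=1}^nw_k}{\prod_{k=1}^nw'_k}\Big)_{n}$ has two different non-zero limit points as $n\to+\infty$ and $B_w$ and $B_{w'}$ do not share the same set of frequently hypercyclic vectors, i.e. $FHC(B_w)\ne FHC(B_{w'})$.
   Context: $\ell^p=\ell^p(\mathbb N_0)$. For a sequence $w=(w_n)_{n\in\mathbb N}$ of non-zero scalars, the weighted backward shift is $B_w(x_0,x_1,x_2,\dots)=(w_1x_1,w_2x_2,w_3x_3,\dots)$, assumed bounded. For $A\subset\mathbb N_0$, $\underline d(A)=\liminf_{n\to\infty}\frac{\#(A\cap[0,n])}{n+1}$. $FHC(T)$ is the set of frequently hypercyclic vectors of $T$, i.e. vectors $u$ with $\underline d(\{k\in\mathbb N_0:T^ku\in U\})>0$ for every non-empty open set $U$; $T$ is frequently hypercyclic if $FHC(T)\neq\varnothing$. *)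

theory Defs
  imports "HOL-Analysis.Analysis"
begin

text \<open>The parameter \<open>p\<close> is a real number, intended to satisfy \<open>1 \<le> p\<close>.\<close>

definition lp :: "real \<Rightarrow> (nat \<Rightarrow> 'a::real_normed_vector) set" where
  "lp p = {x. summable (\<lambda>n. norm (x n) powr p)}"

definition lp_norm :: "real \<Rightarrow> (nat \<Rightarrow> 'a::real_normed_vector) \<Rightarrow> real" where
  "lp_norm p x = (\<Sum>n. norm (x n) powr p) powr (1 / p)"

definition lp_dist :: "real \<Rightarrow> (nat \<Rightarrow> 'a::real_normed_vector) \<Rightarrow> (nat \<Rightarrow> 'a) \<Rightarrow> real" where
  "lp_dist p x y = lp_norm p (\<lambda>n. x n - y n)"

definition lp_topology :: "real \<Rightarrow> (nat \<Rightarrow> 'a::real_normed_vector) topology" where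
  "lp_topology p = Metric_space.mtopology (lp p) (lp_dist p)"

definition lp_bounded ::
  "real \<Rightarrow> ((nat \<Rightarrow> 'a::real_normed_vector) \<Rightarrow> (nat \<Rightarrow> 'a)) \<Rightarrow> bool" where
  "lp_bounded p T \<longleftrightarrow>
     (\<exists>C. \<forall>x\<in>lp p. T x \<in> lp p \<and> lp_norm p (T x) \<le> C * lp_norm p x)"

text \<open>Weights are indexed by \<open>n \<ge> 1\<close>; the value \<open>w 0\<close> is never used.\<close>

definition backward_shift :: "(nat \<Rightarrow> 'a::real_normed_field) \<Rightarrow> (nat \<Rightarrow> 'a) \<Rightarrow> (nat \<Rightarrow> 'a)" where
  "backward_shift w x = (\<lambda>n. w (Suc n) * x (Suc n))"

definition lp_weight :: "real \<Rightarrow> (nat \<Rightarrow> 'a::real_normed_field) \<Rightarrow> bool" where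
  "lp_weight p w \<longleftrightarrow> (\<forall>n\<ge>1. w n \<noteq> 0) \<and> lp_bounded p (backward_shift w)"

definition lower_density :: "nat set \<Rightarrow> ereal" where
  "lower_density A = liminf (\<lambda>n. ereal (real (card (A \<inter> {0..n})) / real (n + 1)))"

definition FHC :: "'x topology \<Rightarrow> ('x \<Rightarrow> 'x) \<Rightarrow> 'x set" where
  "FHC X T = {u \<in> topspace X.
     \<forall>U. openin X U \<and> U \<noteq> {} \<longrightarrow> lower_density {k. (T ^^ k) u \<in> U} > 0}"

definition frequently_hypercyclic :: "'x topology \<Rightarrow> ('x \<Rightarrow> 'x) \<Rightarrow> bool" where
  "frequently_hypercyclic X T \<longleftrightarrow> FHC X T \<noteq> {}"

definition seq_limit_point :: "(nat \<Rightarrow> 'a::topological_space) \<Rightarrow> 'a \<Rightarrow> bool" where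
  "seq_limit_point a l \<longleftrightarrow> (\<exists>r. strict_mono r \<and> (a \<circ> r) \<longlonglongrightarrow> l)"


text \<open>
  The locale constant \<open>Metric_space.mtopology\<close> is meaningful only on an actual metric space;
  the rest of this theory checks, via Minkowski's inequality, that \<open>lp_dist p\<close> is a metric
  on \<open>lp p\<close>.
\<close>

lemma powr_convex_nonneg:
  fixes p t u v :: real
  assumes p: "1 \<le> p" and t: "0 \<le> t" "t \<le> 1" and uv: "0 \<le> u" "0 \<le> v"
  shows "(t * u + (1 - t) * v) powr p \<le> t * u powr p + (1 - t) * v powr p"
proof -
  have sub: "s powr p \<le> s" if "0 \<le> s" "s \<le> 1" for s :: real
  proof (cases "s = 0")
    case False
    then show ?thesis using powr_mono'[of 1 p s] that p by simp
  qed simp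
  consider "u = 0" | "v = 0" | "0 < u" "0 < v" using uv by linarith
  then show ?thesis
  proof cases
    case 1
    then show ?thesis
      using sub[of "1 - t"] t uv by (simp add: powr_mult mult_right_mono)
  next
    case 2
    then show ?thesis
      using sub[of t] t uv by (simp add: powr_mult mult_right_mono)
  next
    case 3
    have "convex_on {0<..} (\<lambda>x::real. x powr p)" using powr_convex[OF p] .
    from convex_onD[OF this, of t v u] show ?thesis
      using t 3 by (simp add: algebra_simps)
  qed
qed

lemma lp_norm_nonneg [simp]: "0 \<le> lp_norm p x"
  by (simp add: lp_norm_def)

lemma lp_norm_powr:
  assumes "1 \<le> p" "x \<in> lp p"
  shows "lp_norm p x powr p = (\<Sum>n. norm (x n) powr p)"
proof -
  have "0 \<le> (\<Sum>n. norm (x n) powr p)"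
    using assms by (intro suminf_nonneg) (auto simp: lp_def)
  then show ?thesis
    using assms by (simp add: lp_norm_def powr_powr)
qed

lemma lp_norm_eq_0_iff:
  assumes "1 \<le> p" "x \<in> lp p"
  shows "lp_norm p x = 0 \<longleftrightarrow> (\<forall>n. x n = 0)"
proof -
  have "lp_norm p x = 0 \<longleftrightarrow> (\<Sum>n. norm (x n) powr p) = 0"
    by (simp add: lp_norm_def)
  also have "\<dots> \<longleftrightarrow> (\<forall>n. norm (x n) powr p = 0)"
    using assms by (intro suminf_eq_zero_iff) (auto simp: lp_def)
  finally show ?thesis by simp
qed

lemma lp_minkowski:
  assumes p: "1 \<le> p" and x: "x \<in> lp p" and y: "y \<in> lp p"
  shows "(\<lambda>n. x n + y n) \<in> lp p"
    and "lp_norm p (\<lambda>n. x n + y n) \<le> lp_norm p x + lp_norm p y"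
proof -
  define a b where "a = lp_norm p x" and "b = lp_norm p y"
  have "(\<lambda>n. x n + y n) \<in> lp p \<and> lp_norm p (\<lambda>n. x n + y n) \<le> a + b"
  proof -
    consider "a = 0" | "b = 0" | "0 < a" "0 < b"
      using lp_norm_nonneg[of p x] lp_norm_nonneg[of p y] unfolding a_def b_def by linarith
    then show ?thesis
    proof cases
      case 1
      then have "\<forall>n. x n = 0" using lp_norm_eq_0_iff[OF p x] a_def by simp
      then show ?thesis using y 1 by (simp add: b_def)
    next
      case 2
      then have "\<forall>n. y n = 0" using lp_norm_eq_0_iff[OF p y] b_def by simp
      then show ?thesis using x 2 by (simp add: a_def)
    next
      case 3
      define s t where "s = a + b" and "t = a / s"
      have s: "0 < s" and t: "0 \<le> t" "t \<le> 1" "1 - t = b / s"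
        using 3 by (auto simp: s_def t_def field_simps)
      define g where "g n = s powr p * (t / a powr p * norm (x n) powr p
        + (1 - t) / b powr p * norm (y n) powr p)" for n
      have le: "norm (x n + y n) powr p \<le> g n" for n
      proof -
        have st: "s * (t * (norm (x n) / a) + (1 - t) * (norm (y n) / b)) = norm (x n) + norm (y n)"
        proof -
          have "s * t = a" "s * (1 - t) = b"
            unfolding t(3) using s by (simp_all add: t_def)
          then show ?thesis using 3 by (simp add: distrib_left flip: mult.assoc)
        qed
        have "norm (x n + y n) powr p \<le> (norm (x n) + norm (y n)) powr p"
          using p by (intro powr_mono2 norm_triangle_ineq) auto
        also have "\<dots> = s powr p * (t * (norm (x n) / a) + (1 - t) * (norm (y n) / b)) powr p"
          unfolding st[symmetric] by (rule powr_mult)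
        also have "\<dots> \<le> s powr p * (t * (norm (x n) / a) powr p + (1 - t) * (norm (y n) / b) powr p)"
          using 3 t p by (intro mult_left_mono powr_convex_nonneg) auto
        also have "\<dots> = g n"
          using 3 by (simp add: g_def powr_divide)
        finally show ?thesis .
      qed
      have sx: "(\<lambda>n. norm (x n) powr p) sums a powr p"
        using x lp_norm_powr[OF p x] by (simp add: a_def lp_def summable_sums)
      have sy: "(\<lambda>n. norm (y n) powr p) sums b powr p"
        using y lp_norm_powr[OF p y] by (simp add: b_def lp_def summable_sums)
      have "g sums (s powr p * (t / a powr p * a powr p + (1 - t) / b powr p * b powr p))"
        unfolding g_def by (intro sums_mult sums_add sx sy)
      then have gs: "g sums (s powr p)" using 3 by simp
      have sm: "summable (\<lambda>n. norm (x n + y n) powr p)"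
        using le by (intro summable_comparison_test'[OF sums_summable[OF gs], of 0]) simp
      have "(\<Sum>n. norm (x n + y n) powr p) \<le> s powr p"
        using suminf_le[OF le sm sums_summable[OF gs]] by (simp only: sums_unique[OF gs, symmetric])
      moreover have "0 \<le> (\<Sum>n. norm (x n + y n) powr p)"
        using sm by (intro suminf_nonneg) auto
      ultimately have "lp_norm p (\<lambda>n. x n + y n) \<le> (s powr p) powr (1 / p)"
        unfolding lp_norm_def using p by (intro powr_mono2) auto
      also have "\<dots> = s" using s p by (simp add: powr_powr)
      finally show ?thesis using sm by (simp add: lp_def s_def)
    qed
  qed
  then show "(\<lambda>n. x n + y n) \<in> lp p" 
    and "lp_norm p (\<lambda>n. x n + y n) \<le> lp_norm p x + lp_norm p y"
    by (simp_all add: a_def b_def)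
qed

lemma lp_diff:
  assumes "1 \<le> p" "x \<in> lp p" "y \<in> lp p"
  shows "(\<lambda>n. x n - y n) \<in> lp p"
  using lp_minkowski(1)[of p x "\<lambda>n. - y n"] assms by (simp add: lp_def)

lemma Metric_space_lp:
  assumes p: "1 \<le> p"
  shows "Metric_space (lp p) (lp_dist p)"
proof
  show "0 \<le> lp_dist p x y" for x y :: "nat \<Rightarrow> 'a"
    by (simp add: lp_dist_def)
  show "lp_dist p x y = lp_dist p y x" for x y :: "nat \<Rightarrow> 'a"
    by (simp add: lp_dist_def lp_norm_def norm_minus_commute)
  show "lp_dist p x y = 0 \<longleftrightarrow> x = y" if "x \<in> lp p" "y \<in> lp p" for x y :: "nat \<Rightarrow> 'a"
    using lp_norm_eq_0_iff[OF p lp_diff[OF p that]] by (auto simp: lp_dist_def)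
  show "lp_dist p x z \<le> lp_dist p x y + lp_dist p y z"
    if "x \<in> lp p" "y \<in> lp p" "z \<in> lp p" for x y z :: "nat \<Rightarrow> 'a"
    using lp_minkowski(2)[OF p lp_diff[OF p that(1,2)] lp_diff[OF p that(2,3)]]
    by (simp add: lp_dist_def)
qed

lemma topspace_lp_topology:
  "1 \<le> p \<Longrightarrow> topspace (lp_topology p) = lp p"
  unfolding lp_topology_def by (rule Metric_space.topspace_mtopology[OF Metric_space_lp])

end

theory Submission
  imports Defs
begin

text \<open>
  Let \<open>u\<close> be a frequently hypercyclic vector of any weighted shift \<open>B\<^sub>w\<close>, and write
  \<open>W\<^sub>k\<close> for the product of \<open>w\<^sub>1, \<dots>, w\<^sub>k\<close>, so that \<open>W\<^sub>k u\<^sub>k\<close> is the first coordinate of the \<open>k\<close>-th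
  iterate of \<open>u\<close>. Choose signs \<open>c\<^sub>k\<close> as a function of \<open>u\<close> itself: \<open>c\<^sub>k = -1\<close> exactly when \<open>W\<^sub>k u\<^sub>k\<close> lies
  in the ball of radius \<open>1/2\<close> about \<open>1\<close>. Multiplication by \<open>c\<close> is an isometry \<open>D\<close>, and
  \<open>D B\<^sub>w D\<close> is again a weighted shift \<open>B\<^sub>w\<^sub>'\<close>, with weights \<open>w'\<^sub>k = c\<^sub>k\<^sub>-\<^sub>1 c\<^sub>k w\<^sub>k\<close>. Hence \<open>D u\<close> is
  frequently hypercyclic for \<open>B\<^sub>w\<^sub>'\<close>. It is not even hypercyclic for \<open>B\<^sub>w\<close>: the first coordinates
  \<open>c\<^sub>k W\<^sub>k u\<^sub>k\<close> of its iterates all avoid that ball, because the sign moves every visit of \<open>u\<close> to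
  the opposite ball. The quotient of the weight products is \<open>c\<^sub>0 c\<^sub>n\<close>. Both signs
  occur infinitely often, since the first coordinates of the iterates of \<open>u\<close> visit the balls of
  radius \<open>1/2\<close> about \<open>1\<close> and about \<open>0\<close> infinitely often. This is
  \<open>frequently_hypercyclic_sign_change\<close>.

  It remains to exhibit one frequently hypercyclic weighted shift, and \<open>2 B\<close> is chosen here. If
  \<open>u\<^sub>n = v\<^sub>n / 2\<^sup>n\<close>, then the \<open>k\<close>-th iterate of \<open>u\<close> is the sequence \<open>v\<^sub>k\<^sub>+\<^sub>n / 2\<^sup>n\<close>, so each finite
  word over a countable dense set of scalars has to occur in \<open>v\<close> at a set of positions of positive
  lower density, and what follows an occurrence must be small after division by \<open>2\<^sup>n\<close>. The
  sequence \<open>v\<close> is a concatenation of blocks, a block of type \<open>j\<close> consisting of \<open>j + 1\<close> zeros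
  followed by \<open>j + 1\<close> entries of norm at most \<open>j + 1\<close>. The zeros keep large entries far
  away: seen from the start of the contents of any block, the later blocks contribute an entry of norm at most
  \<open>n\<close> at distance \<open>n\<close> (\<open>norm_block_seq_after_content\<close>), and \<open>n / 2\<^sup>n\<close> has small tails in
  \<open>\<ell>\<^sup>p\<close>. The type of the \<open>m\<close>-th block is the exponent of \<open>2\<close> in \<open>m + 1\<close>; its average is bounded, so
  the \<open>m\<close>-th block starts at a position linear in \<open>m\<close>, and each type occupies a set of positions of
  positive lower density (\<open>lower_density_content_starts\<close>).
\<close>

section \<open>Weighted shifts and sign changes\<close>

lemma backward_shift_funpow:
  "(backward_shift w ^^ k) x n = prod w {n<..n + k} * x (n + k)"
proof (induction k arbitrary: n)
  case (Suc k)
  have "{n<..n + Suc k} = insert (Suc n) {Suc n<..Suc n + k}" by auto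
  then show ?case using Suc[of "Suc n"] by (simp add: backward_shift_def mult.assoc)
qed simp

lemma norm_coord_le_lp_norm:
  assumes "1 \<le> p" "x \<in> lp p"
  shows "norm (x n) \<le> lp_norm p x"
proof -
  have "norm (x n) powr p \<le> (\<Sum>n. norm (x n) powr p)"
    using sum_le_suminf[of "\<lambda>n. norm (x n) powr p" "{n}"] assms by (simp add: lp_def)
  then have "norm (x n) powr p \<le> lp_norm p x powr p"
    using assms by (simp add: lp_norm_powr)
  then show ?thesis
    using assms powr_less_mono2[of p "lp_norm p x" "norm (x n)"] by force
qed

lemma openin_lp_topology:
  assumes "1 \<le> p"
  shows "openin (lp_topology p) U \<longleftrightarrow>
    U \<subseteq> lp p \<and> (\<forall>x\<in>U. \<exists>r>0. \<forall>y\<in>lp p. lp_dist p x y < r \<longrightarrow> y \<in> U)"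
  unfolding lp_topology_def Metric_space.openin_mtopology[OF Metric_space_lp[OF assms]]
    Metric_space.mball_def[OF Metric_space_lp[OF assms]]
  by blast

text \<open>Sets of this form test an orbit through its first coordinate, the only one whose sign is tracked.\<close>

lemma openin_lp_first_coord:
  assumes p: "1 \<le> p"
  shows "openin (lp_topology p) {x \<in> lp p. norm (x 0 - a) < r}"
  unfolding openin_lp_topology[OF p]
proof (intro conjI ballI)
  fix x assume x: "x \<in> {x \<in> lp p. norm (x 0 - a) < r}"
  show "\<exists>s>0. \<forall>y\<in>lp p. lp_dist p x y < s \<longrightarrow> y \<in> {x \<in> lp p. norm (x 0 - a) < r}"
  proof (intro exI[of _ "r - norm (x 0 - a)"] conjI ballI impI)
    fix y assume y: "y \<in> lp p" "lp_dist p x y < r - norm (x 0 - a)"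
    have "norm (x 0 - y 0) \<le> lp_dist p x y"
      using norm_coord_le_lp_norm[OF p lp_diff[OF p]] x y by (auto simp: lp_dist_def)
    moreover have "norm (y 0 - a) \<le> norm (x 0 - a) + norm (x 0 - y 0)"
      using norm_triangle_ineq4[of "x 0 - a" "x 0 - y 0"] by simp
    ultimately show "y \<in> {x \<in> lp p. norm (x 0 - a) < r}" using y by auto
  qed (use x in auto)
qed auto

lemma lp_single: "1 \<le> p \<Longrightarrow> (\<lambda>n. if n = 0 then a else 0) \<in> lp p"
  unfolding lp_def by (auto intro!: summable_finite[of "{0}"] split: if_splits)

lemma lp_mono:
  assumes "1 \<le> p" "y \<in> lp p" "\<And>n. norm (x n) \<le> norm (y n)"
  shows "x \<in> lp p"
  using assms unfolding lp_def
  by (auto intro!: summable_comparison_test'[where g = "\<lambda>n. norm (y n) powr p" and N = 0] powr_mono2)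

lemma infinite_of_lower_density_pos:
  assumes "lower_density A > 0"
  shows "infinite A"
proof
  assume A: "finite A"
  have "(\<lambda>n. ereal (real (card (A \<inter> {0..n})) / real (n + 1))) \<longlonglongrightarrow> ereal 0"
    unfolding lim_ereal
  proof (rule tendsto_sandwich[of "\<lambda>_. 0" _ _ "\<lambda>n. real (card A) / real (n + 1)"])
    show "\<forall>\<^sub>F n in sequentially.
      real (card (A \<inter> {0..n})) / real (n + 1) \<le> real (card A) / real (n + 1)"
      using A by (intro always_eventually allI divide_right_mono) (auto intro: card_mono)
    show "(\<lambda>n. real (card A) / real (n + 1)) \<longlonglongrightarrow> 0"
      using LIMSEQ_Suc[OF lim_const_over_n[of "real (card A)"]] by simp
  qed auto
  then have "lower_density A = ereal 0"
    unfolding lower_density_def by (intro lim_imp_Liminf trivial_limit_sequentially)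
  then show False using assms by simp
qed

lemma FHC_infinitely_many_visits:
  assumes "u \<in> FHC X T" "openin X U" "U \<noteq> {}"
  shows "infinite {k. (T ^^ k) u \<in> U}"
proof (rule infinite_of_lower_density_pos)
  have "\<forall>U. openin X U \<and> U \<noteq> {} \<longrightarrow> lower_density {k. (T ^^ k) u \<in> U} > 0"
    using assms(1) by (simp add: FHC_def)
  then show "lower_density {k. (T ^^ k) u \<in> U} > 0" using assms(2,3) by blast
qed

text \<open>Frequent hypercyclicity passes through a semiconjugacy \<open>h\<close>, because the orbit of \<open>h u\<close> visits \<open>U\<close>
  exactly when the orbit of \<open>u\<close> visits the preimage of \<open>U\<close>, which is open and, as \<open>h\<close> is onto,
  non-empty.\<close>

lemma FHC_image:
  assumes u: "u \<in> FHC X T"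
    and h: "continuous_map X Y h" "h ` topspace X = topspace Y"
    and T: "\<And>x. x \<in> topspace X \<Longrightarrow> T x \<in> topspace X"
    and conj: "\<And>x. x \<in> topspace X \<Longrightarrow> h (T x) = S (h x)"
  shows "h u \<in> FHC Y S"
proof -
  have uX: "u \<in> topspace X" using u by (simp add: FHC_def)
  have Tk: "(T ^^ k) u \<in> topspace X" for k
    by (induction k) (auto simp: uX T)
  have Sk: "(S ^^ k) (h u) = h ((T ^^ k) u)" for k
    by (induction k) (simp_all add: conj Tk)
  have "lower_density {k. (S ^^ k) (h u) \<in> U} > 0" if U: "openin Y U" "U \<noteq> {}" for U
  proof -
    define V where "V = {x \<in> topspace X. h x \<in> U}"
    have "openin X V" unfolding V_def using h U by (intro openin_continuous_map_preimage)
    moreover have "V \<noteq> {}"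
    proof -
      obtain y where "y \<in> U" using U(2) by blast
      moreover from this have "y \<in> h ` topspace X" using openin_subset[OF U(1)] h(2) by blast
      ultimately show ?thesis unfolding V_def by blast
    qed
    ultimately have "lower_density {k. (T ^^ k) u \<in> V} > 0" using u by (simp add: FHC_def)
    then show ?thesis by (simp add: V_def Tk Sk)
  qed
  then show ?thesis using uX h(2) by (auto simp: FHC_def)
qed

lemma lp_unimodular_mult:
  fixes x :: "nat \<Rightarrow> 'a::real_normed_field"
  assumes "\<And>n. norm (c n) = 1"
  shows "(\<lambda>n. c n * x n) \<in> lp p \<longleftrightarrow> x \<in> lp p" "lp_norm p (\<lambda>n. c n * x n) = lp_norm p x"
  using assms by (simp_all add: lp_def lp_norm_def norm_mult)

lemma continuous_map_lp_unimodular: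
  fixes c :: "nat \<Rightarrow> 'a::real_normed_field"
  assumes p: "1 \<le> p" and c: "\<And>n. norm (c n) = 1"
  shows "continuous_map (lp_topology p) (lp_topology p) (\<lambda>x n. c n * x n)"
  unfolding continuous_map_def topspace_lp_topology[OF p]
proof (intro conjI allI impI)
  show "(\<lambda>x n. c n * x n) \<in> lp p \<rightarrow> lp p"
    using c by (simp add: lp_unimodular_mult)
  fix U :: "(nat \<Rightarrow> 'a) set" assume U: "openin (lp_topology p) U"
  have iso: "lp_dist p (\<lambda>n. c n * x n) (\<lambda>n. c n * y n) = lp_dist p x y" for x y :: "nat \<Rightarrow> 'a"
    using lp_unimodular_mult(2)[of c p "\<lambda>n. x n - y n", OF c]
    by (simp add: lp_dist_def algebra_simps)
  show "openin (lp_topology p) {x \<in> lp p. (\<lambda>n. c n * x n) \<in> U}"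
    unfolding openin_lp_topology[OF p]
  proof (intro conjI ballI)
    fix x assume x: "x \<in> {x \<in> lp p. (\<lambda>n. c n * x n) \<in> U}"
    then obtain r where r: "r > 0"
      "\<And>y. y \<in> lp p \<Longrightarrow> lp_dist p (\<lambda>n. c n * x n) y < r \<Longrightarrow> y \<in> U"
      using U unfolding openin_lp_topology[OF p] by blast
    show "\<exists>r>0. \<forall>y\<in>lp p. lp_dist p x y < r \<longrightarrow> y \<in> {x \<in> lp p. (\<lambda>n. c n * x n) \<in> U}"
      using r c by (intro exI[of _ r]) (auto simp: iso lp_unimodular_mult)
  qed auto
qed

lemma seq_limit_point_of_infinite:
  assumes "infinite {n. a n = l}"
  shows "seq_limit_point a l"
proof -
  obtain r :: "nat \<Rightarrow> nat" where "strict_mono r" "\<And>n. r n \<in> {n. a n = l}"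
    using infinite_enumerate[OF assms] by blast
  then show ?thesis
    unfolding seq_limit_point_def by (intro exI[of _ r]) (auto simp: comp_def)
qed

text \<open>The signs depend on a frequently hypercyclic vector \<open>u\<close>, and are chosen so that flipping the
  coordinates of \<open>u\<close> by them keeps the orbit under \<open>B\<^sub>w\<close> out of a fixed open set, while the same
  flip conjugates \<open>B\<^sub>w\<close> to the new shift.\<close>

lemma frequently_hypercyclic_sign_change:
  fixes w :: "nat \<Rightarrow> 'a::real_normed_field"
  assumes p: "1 \<le> p" and w: "lp_weight p w"
    and fhc: "frequently_hypercyclic (lp_topology p) (backward_shift w)"
  shows "\<exists>w'. lp_weight p w' \<and> frequently_hypercyclic (lp_topology p) (backward_shift w') \<and>
    (\<exists>l l'. l \<noteq> l' \<and> l \<noteq> 0 \<and> l' \<noteq> 0 \<and>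
      seq_limit_point (\<lambda>n. (\<Prod>k=1..n. w k) / (\<Prod>k=1..n. w' k)) l \<and>
      seq_limit_point (\<lambda>n. (\<Prod>k=1..n. w k) / (\<Prod>k=1..n. w' k)) l') \<and>
    FHC (lp_topology p) (backward_shift w) \<noteq> FHC (lp_topology p) (backward_shift w')"
proof -
  let ?X = "lp_topology p :: (nat \<Rightarrow> 'a) topology"
  obtain u where u: "u \<in> FHC ?X (backward_shift w)"
    using fhc by (auto simp: frequently_hypercyclic_def)
  define W where "W k = prod w {1..k}" for k
  have W0: "W k \<noteq> 0" for k using w by (auto simp: W_def lp_weight_def)
  have orbit: "(backward_shift w ^^ k) x 0 = W k * x k" for x k
    by (simp add: backward_shift_funpow W_def atLeastSucAtMost_greaterThanAtMost)
  define c :: "nat \<Rightarrow> 'a" where "c k = (if norm (W k * u k - 1) < 1/2 then -1 else 1)" for k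
  have c_cases: "c k = 1 \<or> c k = -1" for k by (simp add: c_def)
  have c_norm [simp]: "norm (c k) = 1" for k by (simp add: c_def)
  have c_sq [simp]: "c k * c k = 1" for k by (simp add: c_def)
  have c_nz [simp]: "c k \<noteq> 0" for k by (simp add: c_def)
  define w' where "w' n = c (n - 1) * c n * w n" for n
  define D where "D x = (\<lambda>n. c n * x n)" for x :: "nat \<Rightarrow> 'a"
  have conj: "backward_shift w' (D x) = D (backward_shift w x)" for x
  proof
    fix n
    have "c n * c (Suc n) * w (Suc n) * (c (Suc n) * x (Suc n))
        = c n * (w (Suc n) * x (Suc n)) * (c (Suc n) * c (Suc n))"
      by (simp only: ac_simps)
    then show "backward_shift w' (D x) n = D (backward_shift w x) n"
      by (simp add: backward_shift_def D_def w'_def)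
  qed
  have DD: "D (D x) = x" for x
    by (simp add: D_def flip: mult.assoc)
  have D_lp: "D x \<in> lp p \<longleftrightarrow> x \<in> lp p" "lp_norm p (D x) = lp_norm p x" for x
    unfolding D_def by (simp_all add: lp_unimodular_mult)
  have w'_eq: "backward_shift w' x = D (backward_shift w (D x))" for x
    using conj[of "D x"] by (simp add: DD)
  have w': "lp_weight p w'"
  proof -
    obtain C where "\<forall>x\<in>lp p. backward_shift w x \<in> lp p \<and>
        lp_norm p (backward_shift w x) \<le> C * lp_norm p x"
      using w unfolding lp_weight_def lp_bounded_def by blast
    then have "\<forall>x\<in>lp p. backward_shift w (D x) \<in> lp p \<and>
        lp_norm p (backward_shift w (D x)) \<le> C * lp_norm p (D x)"
      using D_lp(1) by blast
    then have "\<forall>x\<in>lp p. backward_shift w' x \<in> lp p \<and>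
        lp_norm p (backward_shift w' x) \<le> C * lp_norm p x"
      unfolding w'_eq D_lp .
    then show ?thesis
      using w unfolding lp_weight_def lp_bounded_def by (auto simp: w'_def)
  qed
  have Du: "D u \<in> FHC ?X (backward_shift w')"
  proof (rule FHC_image[OF u])
    show "continuous_map ?X ?X D"
      unfolding D_def by (intro continuous_map_lp_unimodular p) simp
    show "D ` topspace ?X = topspace ?X"
      unfolding topspace_lp_topology[OF p]
    proof (intro equalityI subsetI)
      show "x \<in> D ` lp p" if "x \<in> lp p" for x
        using that by (intro image_eqI[of _ _ "D x"]) (simp_all only: DD D_lp(1))
    qed (use D_lp(1) in blast)
    show "backward_shift w x \<in> topspace ?X" if "x \<in> topspace ?X" for x
      using that w unfolding topspace_lp_topology[OF p] lp_weight_def lp_bounded_def by blast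
  qed (simp add: conj)
  have open_nonempty: "openin ?X {x \<in> lp p. norm (x 0 - a) < 1/2}"
    "{x \<in> lp p. norm (x 0 - a) < 1/2} \<noteq> {}" for a :: 'a
  proof -
    have "(\<lambda>n. if n = 0 then a else 0) \<in> {x \<in> lp p. norm (x 0 - a) < 1/2}"
      using lp_single[OF p, of a] by simp
    then show "{x \<in> lp p. norm (x 0 - a) < 1/2} \<noteq> {}" by blast
  qed (rule openin_lp_first_coord[OF p])
  have hits: "infinite {k. norm (W k * x k - a) < 1/2}" if "x \<in> FHC ?X (backward_shift w)" for x a
    using FHC_infinitely_many_visits[OF that open_nonempty[of a]]
    by (rule infinite_super[rotated]) (auto simp: orbit)
  have "D u \<notin> FHC ?X (backward_shift w)"
  proof
    assume "D u \<in> FHC ?X (backward_shift w)"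
    from infinite_imp_nonempty[OF hits[OF this, of 1]]
    obtain k where k: "norm (W k * D u k - 1) < 1/2" by blast
    show False
    proof (cases "norm (W k * u k - 1) < 1/2")
      case True
      \<comment> \<open>A scalar and its negative would both be within \<open>1/2\<close> of \<open>1\<close>; the two errors add up to \<open>-2\<close>.\<close>
      then have "norm (- (W k * u k) - 1) < 1/2"
        using k by (simp add: D_def c_def)
      with True have "norm ((W k * u k - 1) + (- (W k * u k) - 1)) < 1/2 + 1/2"
        by (intro norm_add_less)
      moreover have "(W k * u k - 1) + (- (W k * u k) - 1) = -2" by simp
      ultimately show False by simp
    next
      case False
      then show False using k by (simp add: D_def c_def)
    qed
  qed
  then have ne: "FHC ?X (backward_shift w) \<noteq> FHC ?X (backward_shift w')"
    using Du by blast
  have prod_w': "(\<Prod>k=1..n. w' k) = c 0 * c n * W n" for n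
  proof (induction n)
    case (Suc n)
    have "c 0 * c n * W n * (c n * c (Suc n) * w (Suc n))
        = c 0 * c (Suc n) * (W n * w (Suc n)) * (c n * c n)"
      by (simp only: ac_simps)
    then show ?case using Suc by (simp add: w'_def W_def)
  qed (simp add: W_def)
  have ratio: "(\<Prod>k=1..n. w k) / (\<Prod>k=1..n. w' k) = c 0 * c n" for n
    unfolding prod_w' using W0[of n] c_cases[of 0] c_cases[of n] by (auto simp: W_def)
  have "infinite {k. c k = -1}"
    using hits[OF u, of 1] by (rule infinite_super[rotated]) (auto simp: c_def)
  then have lim1: "seq_limit_point (\<lambda>n. c 0 * c n) (- c 0)"
    by (intro seq_limit_point_of_infinite) (auto elim!: infinite_super[rotated])
  have "infinite {k. c k = 1}"
    using hits[OF u, of 0]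
  proof (rule infinite_super[rotated], safe)
    fix k assume "norm (W k * u k - 0) < 1/2"
    then have "\<not> norm (W k * u k - 1) < 1/2"
      using norm_triangle_ineq4[of "W k * u k" "W k * u k - 1"] by auto
    then show "c k = 1" by (simp add: c_def)
  qed
  then have lim2: "seq_limit_point (\<lambda>n. c 0 * c n) (c 0)"
    by (intro seq_limit_point_of_infinite) (auto elim!: infinite_super[rotated])
  have "- c 0 \<noteq> c 0" using c_cases[of 0] by auto
  then have lims: "\<exists>l l'. l \<noteq> l' \<and> l \<noteq> 0 \<and> l' \<noteq> 0 \<and>
      seq_limit_point (\<lambda>n. (\<Prod>k=1..n. w k) / (\<Prod>k=1..n. w' k)) l \<and>
      seq_limit_point (\<lambda>n. (\<Prod>k=1..n. w k) / (\<Prod>k=1..n. w' k)) l'"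
    unfolding ratio using lim1 lim2 by (intro exI[of _ "- c 0"] exI[of _ "c 0"]) simp
  have fhc': "frequently_hypercyclic ?X (backward_shift w')"
    using Du by (auto simp: frequently_hypercyclic_def)
  show ?thesis
    by (rule exI[of _ w']) (intro conjI w' fhc' lims ne)
qed

section \<open>Blocks arranged by the ruler sequence\<close>

text \<open>The exponent of \<open>2\<close> in \<open>m + 1\<close>.\<close>

function ruler :: "nat \<Rightarrow> nat" where
  "ruler m = (if even m then 0 else Suc (ruler (m div 2)))"
  by auto
termination by (relation "less_than") (auto elim: oddE)

declare ruler.simps [simp del]

lemma ruler_even [simp]: "ruler (2 * m) = 0"
  and ruler_odd [simp]: "ruler (Suc (2 * m)) = Suc (ruler m)"
  by (simp_all add: ruler.simps)

lemma ruler_value: "ruler (2 ^ j * (2 * q + 1) - 1) = j"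
proof (induction j)
  case (Suc j)
  have "2 ^ j * (2 * q + 1) > (0::nat)" by simp
  then have "2 ^ Suc j * (2 * q + 1) - 1 = Suc (2 * (2 ^ j * (2 * q + 1) - 1))"
    unfolding power_Suc mult.assoc by linarith
  then show ?case using Suc by simp
qed simp

text \<open>The sum is the exponent of \<open>2\<close> in \<open>m!\<close>. The even arguments below \<open>m\<close> contribute nothing, and the
  odd ones contribute \<open>1\<close> each plus the same sum for \<open>m div 2\<close>.\<close>

lemma sum_ruler_le: "(\<Sum>i<m. ruler i) \<le> m"
proof (induction m rule: less_induct)
  case (less m)
  have double: "(\<Sum>i<2 * n. ruler i) = n + (\<Sum>i<n. ruler i)" for n
    by (induction n) simp_all
  show ?case
  proof (cases "m = 0")
    case False
    then have le: "(\<Sum>i<m div 2. ruler i) \<le> m div 2" by (intro less) simp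
    show ?thesis
    proof (cases "even m")
      case True
      then show ?thesis using double[of "m div 2"] le by simp
    next
      case False
      then have m: "m = Suc (2 * (m div 2))" by simp
      have "(\<Sum>i<Suc (2 * (m div 2)). ruler i) \<le> Suc (2 * (m div 2))"
        using double[of "m div 2"] le by simp
      then show ?thesis using m by simp
    qed
  qed simp
qed

text \<open>A block of type \<open>j\<close> has length \<open>2 (j + 1)\<close>: the zeros, then the contents.\<close>

definition block_start :: "nat \<Rightarrow> nat" where
  "block_start m = (\<Sum>i<m. 2 * Suc (ruler i))"

definition block_of :: "nat \<Rightarrow> nat" where
  "block_of n = (LEAST m. n < block_start (Suc m))"

definition block_offset :: "nat \<Rightarrow> nat" where
  "block_offset n = n - block_start (block_of n)"

definition block_seq :: "(nat \<Rightarrow> nat \<Rightarrow> 'a::zero) \<Rightarrow> nat \<Rightarrow> 'a" where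
  "block_seq z n = (let j = ruler (block_of n); r = block_offset n in
     if r \<le> j then 0 else z j (r - Suc j))"

lemma block_start_Suc: "block_start (Suc m) = block_start m + 2 * Suc (ruler m)"
  by (simp add: block_start_def)

lemma strict_mono_block_start: "strict_mono block_start"
  by (rule strict_monoI_Suc) (simp add: block_start_Suc)

lemma block_start_le: "block_start m \<le> 4 * m"
proof -
  have "block_start m = 2 * m + 2 * (\<Sum>i<m. ruler i)"
    by (induction m) (simp_all add: block_start_def)
  then show ?thesis using sum_ruler_le[of m] by simp
qed

lemma block_of_eq:
  assumes "block_start m \<le> n" "n < block_start (Suc m)"
  shows "block_of n = m"
  unfolding block_of_def
proof (rule Least_equality)
  fix m' assume "n < block_start (Suc m')"
  with assms(1) have "block_start m < block_start (Suc m')" by simp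
  then show "m \<le> m'" using strict_mono_less[OF strict_mono_block_start] by simp
qed fact

lemma block_start_mono_block_of:
  assumes "block_start m \<le> n"
  shows "block_start m \<le> block_start (block_of n)"
proof -
  have "n < block_start (Suc n)"
    using strict_mono_imp_increasing[OF strict_mono_block_start, of "Suc n"] by simp
  then have "n < block_start (Suc (block_of n))" unfolding block_of_def by (rule LeastI)
  with assms have "block_start m < block_start (Suc (block_of n))" by simp
  then show ?thesis
    using strict_mono_less[OF strict_mono_block_start]
      strict_mono_less_eq[OF strict_mono_block_start] by simp
qed

lemma block_seq_content:
  assumes "n \<le> ruler m"
  shows "block_seq z (block_start m + Suc (ruler m) + n) = z (ruler m) n"
proof -
  have "block_of (block_start m + Suc (ruler m) + n) = m"
    using assms by (intro block_of_eq) (auto simp: block_start_Suc)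
  then show ?thesis by (simp add: block_seq_def block_offset_def)
qed

lemma norm_block_seq_le:
  fixes z :: "nat \<Rightarrow> nat \<Rightarrow> 'a::real_normed_vector"
  assumes "\<And>j n. norm (z j n) \<le> Suc j"
  shows "norm (block_seq z n) \<le> block_offset n"
proof (cases "block_offset n \<le> ruler (block_of n)")
  case False
  then show ?thesis
    using assms[of "ruler (block_of n)" "block_offset n - Suc (ruler (block_of n))"]
    by (simp add: block_seq_def Let_def)
qed (simp add: block_seq_def)

text \<open>A nonzero entry of a later block of type \<open>i\<close> is preceded by the \<open>i + 1\<close> zeros of that block, so it
  has norm at most \<open>i + 1 \<le> n\<close>. The block may be of arbitrarily large type, but then it
  has a correspondingly long run of zeros.\<close>

lemma norm_block_seq_after_content:
  fixes z :: "nat \<Rightarrow> nat \<Rightarrow> 'a::real_normed_vector"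
  assumes "\<And>j n. norm (z j n) \<le> Suc j" "ruler m < n"
  shows "norm (block_seq z (block_start m + Suc (ruler m) + n)) \<le> n"
proof -
  let ?N = "block_start m + Suc (ruler m) + n"
  have "block_start (Suc m) \<le> ?N" using assms by (simp add: block_start_Suc)
  then have "block_start (Suc m) \<le> block_start (block_of ?N)"
    by (rule block_start_mono_block_of)
  then have "block_offset ?N \<le> n" by (simp add: block_offset_def block_start_Suc)
  then show ?thesis using norm_block_seq_le[of z ?N, OF assms(1)] by linarith
qed

lemma lower_density_mono:
  assumes "A \<subseteq> B"
  shows "lower_density A \<le> lower_density B"
  unfolding lower_density_def
  using assms by (intro Liminf_mono always_eventually allI) (auto intro!: divide_right_mono card_mono)

lemma lower_density_pos_of_linear_growth:
  fixes a :: "nat \<Rightarrow> nat"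
  assumes a: "inj a" "\<And>q. a q \<le> C * Suc q" and C: "C > 0"
  shows "lower_density (range a) > 0"
proof -
  have ev: "1 / (2 * real C) \<le> real (card (range a \<inter> {0..n})) / real (n + 1)" if n: "n \<ge> 4 * C" for n
  proof -
    have "a ` {..<n div C} \<subseteq> range a \<inter> {0..n}"
    proof safe
      fix q assume "q < n div C"
      then have "C * Suc q \<le> C * (n div C)" by (intro mult_le_mono2 Suc_leI)
      also have "\<dots> \<le> n" by simp
      finally show "a q \<in> {0..n}" using a(2)[of q] by simp
    qed simp
    from card_mono[OF _ this] have "n div C \<le> card (range a \<inter> {0..n})"
      using a(1) by (simp add: card_image inj_on_subset)
    moreover have "real n < C * real (n div C) + C"
    proof -
      have "n < C * (n div C) + C" using dividend_less_times_div[OF C, of n] by simp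
      then show ?thesis by (simp flip: of_nat_mult of_nat_add)
    qed
    ultimately have "real n < C * real (card (range a \<inter> {0..n})) + C"
      by (smt (verit) mult_left_mono of_nat_0_le_iff of_nat_mono)
    moreover have "real n \<ge> 4 * real C" using n by (simp flip: of_nat_mult)
    ultimately show ?thesis using C by (simp add: field_simps)
  qed
  have "0 < ereal (1 / (2 * real C))" using C by simp
  also have "\<dots> \<le> lower_density (range a)"
    unfolding lower_density_def
    by (intro Liminf_bounded eventually_sequentiallyI[of "4 * C"]) (use ev in simp)
  finally show ?thesis .
qed

text \<open>The blocks of type \<open>j\<close> are those of index \<open>2\<^sup>j (2 q + 1) - 1\<close>, and block starts grow linearly in
  the index.\<close>

lemma lower_density_content_starts:
  assumes "\<And>m. ruler m = j \<Longrightarrow> block_start m + Suc j \<in> A"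
  shows "lower_density A > 0"
proof -
  define a where "a q = block_start (2 ^ j * (2 * q + 1) - 1) + Suc j" for q
  have "lower_density (range a) > 0"
  proof (rule lower_density_pos_of_linear_growth)
    show "inj a"
    proof (rule injI)
      fix q q' assume "a q = a q'"
      then have "2 ^ j * (2 * q + 1) - 1 = 2 ^ j * (2 * q' + 1) - (1::nat)"
        using strict_mono_eq[OF strict_mono_block_start] by (simp add: a_def)
      moreover have "2 ^ j * (2 * q + 1) > (0::nat)" "2 ^ j * (2 * q' + 1) > (0::nat)" by simp_all
      ultimately have "2 ^ j * (2 * q + 1) = 2 ^ j * (2 * q' + (1::nat))" by linarith
      then show "q = q'" by simp
    qed
    show "a q \<le> (8 * 2 ^ j + Suc j) * Suc q" for q
    proof -
      have "a q \<le> 4 * (2 ^ j * (2 * q + 1) - 1) + Suc j"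
        using block_start_le by (simp add: a_def)
      also have "\<dots> \<le> 8 * 2 ^ j * Suc q + Suc j * Suc q"
        by (intro add_mono) (auto simp: algebra_simps)
      finally show ?thesis by (simp add: algebra_simps)
    qed
  qed simp
  moreover have "range a \<subseteq> A" using assms ruler_value by (auto simp: a_def)
  ultimately show ?thesis using lower_density_mono by (metis less_le_trans)
qed

section \<open>A frequently hypercyclic vector for the doubled backward shift\<close>

text \<open>The word in the block of type \<open>j\<close>. The first component of the pair coded by \<open>j\<close> takes each
  value for arbitrarily large \<open>j\<close>, so every word has arbitrarily long blocks; entries
  that are still too large for their \<open>j\<close> are replaced by \<open>0\<close>, which enforces the norm bound on the contents of a block.\<close>

definition word :: "(nat \<Rightarrow> 'a::real_normed_vector) \<Rightarrow> nat \<Rightarrow> nat \<Rightarrow> 'a" where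
  "word d j n = (let l = from_nat (fst (prod_decode j)) :: nat list in
     if n < length l \<and> norm (d (l ! n)) \<le> Suc j then d (l ! n) else 0)"

lemma norm_word_le: "norm (word d j n) \<le> Suc j"
  by (simp add: word_def Let_def)

lemma word_realizes:
  "\<exists>j\<ge>N. (\<forall>n<N. word d j n = d (i n)) \<and> (\<forall>n\<ge>N. word d j n = 0)"
proof -
  define l where "l = map i [0..<N]"
  define M where "M = Max (insert 0 ((\<lambda>n. norm (d (i n))) ` {..<N}))"
  \<comment> \<open>A code is at least as large as the second component of its pair, hence at least \<open>N\<close> and all the norms.\<close>
  define j where "j = prod_encode (to_nat l, N + nat \<lceil>M\<rceil>)"
  have j: "N + nat \<lceil>M\<rceil> \<le> j" unfolding j_def by (rule le_prod_encode_2)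
  have l: "from_nat (fst (prod_decode j)) = l" by (simp add: j_def)
  have "word d j n = d (i n)" if "n < N" for n
  proof -
    have "norm (d (i n)) \<le> M" unfolding M_def using that by (intro Max_ge) auto
    also have "M \<le> Suc j" using j by linarith
    finally show ?thesis using that by (simp add: word_def l l_def)
  qed
  moreover have "word d j n = 0" if "n \<ge> N" for n
    using that by (simp add: word_def l l_def)
  ultimately show ?thesis using j by (intro exI[of _ j]) auto
qed

lemma linear_over_exponential_in_lp:
  assumes "1 \<le> p"
  shows "(\<lambda>n. real n / 2 ^ n) \<in> lp p"
proof -
  have "summable (\<lambda>n. real n / 2 ^ n)"
  proof -
    have "(\<lambda>n. real (Suc n) * (1/2) ^ n) sums (1 / (1 - 1/2)\<^sup>2)"
      by (rule geometric_deriv_sums) simp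
    from sums_summable[OF this] show ?thesis
      by (rule summable_comparison_test'[where N = 0]) (simp add: power_divide divide_right_mono)
  qed
  moreover have "norm (norm (real n / 2 ^ n) powr p) \<le> real n / 2 ^ n" for n
  proof (cases "n = 0")
    case False
    have "real n < 2 ^ n" by (rule of_nat_less_two_power)
    then show ?thesis
      using powr_mono'[of 1 p "real n / 2 ^ n"] assms by simp
  qed simp
  ultimately show ?thesis
    unfolding lp_def by (auto intro: summable_comparison_test'[where N = 0])
qed

text \<open>The scheme of all approximations below: finitely many coordinates are uniformly small, and the
  others are dominated by the tail of a fixed element of \<open>\<ell>\<^sup>p\<close>.\<close>

lemma lp_norm_less_split:
  fixes x :: "nat \<Rightarrow> 'a::real_normed_vector" and G :: "nat \<Rightarrow> real"
  assumes p: "1 \<le> p" and x: "x \<in> lp p" and G: "G \<in> lp p" and eps: "\<epsilon> > 0"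
    and head: "\<And>n. n < N \<Longrightarrow> norm (x n) \<le> \<delta>" "real N * \<delta> powr p < \<epsilon> powr p / 2"
    and tail: "\<And>n. n \<ge> N \<Longrightarrow> norm (x n) \<le> norm (G n)"
      "(\<Sum>n. norm (G (n + N)) powr p) < \<epsilon> powr p / 2"
  shows "lp_norm p x < \<epsilon>"
proof -
  have sx: "summable (\<lambda>n. norm (x n) powr p)" using x by (simp add: lp_def)
  have sG: "summable (\<lambda>n. norm (G n) powr p)" using G by (simp add: lp_def)
  have "lp_norm p x powr p = (\<Sum>n. norm (x (n + N)) powr p) + (\<Sum>n<N. norm (x n) powr p)"
    unfolding lp_norm_powr[OF p x] by (rule suminf_split_initial_segment[OF sx])
  also have "(\<Sum>n. norm (x (n + N)) powr p) \<le> (\<Sum>n. norm (G (n + N)) powr p)"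
    using p tail sx sG by (intro suminf_le powr_mono2 summable_ignore_initial_segment) auto
  also have "\<dots> < \<epsilon> powr p / 2" by (rule tail)
  also have "(\<Sum>n<N. norm (x n) powr p) \<le> (\<Sum>n<N. \<delta> powr p)"
    using p head(1) by (intro sum_mono powr_mono2) auto
  also have "\<dots> < \<epsilon> powr p / 2" using head(2) by simp
  finally have "lp_norm p x powr p < \<epsilon> powr p" by simp
  then show ?thesis using p eps powr_mono2[of p \<epsilon> "lp_norm p x"] by force
qed

lemma lp_weight_two:
  assumes p: "1 \<le> p"
  shows "lp_weight p (\<lambda>_. 2 :: 'a::real_normed_field)"
proof -
  have "backward_shift (\<lambda>_. 2) x \<in> lp p \<and> lp_norm p (backward_shift (\<lambda>_. 2) x) \<le> 2 * lp_norm p x"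
    if x: "x \<in> lp p" for x :: "nat \<Rightarrow> 'a"
  proof -
    have sx: "summable (\<lambda>n. norm (x n) powr p)" using x by (simp add: lp_def)
    then have s: "summable (\<lambda>n. norm (x (Suc n)) powr p)" by (subst summable_Suc_iff)
    have nrm: "norm (backward_shift (\<lambda>_. 2) x n) powr p = 2 powr p * norm (x (Suc n)) powr p" for n
      by (simp add: backward_shift_def norm_mult powr_mult)
    have mem: "backward_shift (\<lambda>_. 2) x \<in> lp p"
      unfolding lp_def mem_Collect_eq nrm using s by (rule summable_mult)
    have "(\<Sum>n. norm (x (Suc n)) powr p) \<le> (\<Sum>n. norm (x n) powr p)"
      using suminf_split_head[OF sx] by simp
    then have "lp_norm p (backward_shift (\<lambda>_. 2) x) powr p \<le> 2 powr p * lp_norm p x powr p"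
      unfolding lp_norm_powr[OF p mem] lp_norm_powr[OF p x] nrm suminf_mult[OF s] by simp
    also have "\<dots> = (2 * lp_norm p x) powr p" by (simp add: powr_mult)
    finally have "lp_norm p (backward_shift (\<lambda>_. 2) x) \<le> 2 * lp_norm p x"
      using p powr_less_mono2[of p "2 * lp_norm p x" "lp_norm p (backward_shift (\<lambda>_. 2) x)"]
      by force
    then show ?thesis using mem by simp
  qed
  then show ?thesis unfolding lp_weight_def lp_bounded_def by auto
qed

text \<open>The scalars are separable, so words over a countable dense set suffice to approximate
  the first \<open>N\<close> coordinates of any \<open>t\<close>. For the remaining coordinates the error is dominated by
  \<open>\<bar>t\<^sub>n\<bar> + n / 2\<^sup>n\<close>, which does not depend on the position of the block.\<close>

lemma frequently_hypercyclic_doubled_shift: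
  assumes p: "1 \<le> p"
  shows "frequently_hypercyclic (lp_topology p)
    (backward_shift (\<lambda>_. 2 :: 'a::{real_normed_field, euclidean_space}))"
proof -
  obtain D :: "'a set" where D: "countable D" "\<And>X. open X \<Longrightarrow> X \<noteq> {} \<Longrightarrow> \<exists>d\<in>D. d \<in> X"
    using countable_dense_setE by blast
  define d where "d = from_nat_into D"
  have dense: "\<exists>i. norm (d i - b) < \<delta>" if \<delta>: "\<delta> > 0" for b \<delta>
  proof -
    obtain e where e: "e \<in> D" "e \<in> ball b \<delta>" using D(2)[of "ball b \<delta>"] \<delta> by auto
    then obtain i where "d i = e"
      using from_nat_into_surj[OF D(1)] unfolding d_def by blast
    then show ?thesis using e by (auto simp: dist_norm norm_minus_commute)
  qed
  define v where "v = block_seq (word d)"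
  define u where "u n = v n / 2 ^ n" for n
  define g where "g n = real n / 2 ^ n" for n
  have g: "g \<in> lp p" unfolding g_def using p by (rule linear_over_exponential_in_lp)
  have v_le: "norm (v n) \<le> n" for n
    using norm_block_seq_le[of "word d" n, OF norm_word_le]
    by (simp add: v_def block_offset_def)
  have u: "u \<in> lp p"
  proof (rule lp_mono[OF p g])
    show "norm (u n) \<le> norm (g n)" for n
      using v_le[of n] by (simp add: u_def g_def norm_divide norm_power divide_right_mono)
  qed
  have orbit: "(backward_shift (\<lambda>_. 2) ^^ k) u n = v (k + n) / 2 ^ n" for k n
    by (simp add: backward_shift_funpow u_def power_add add.commute)
  have orbit_lp: "(backward_shift (\<lambda>_. 2) ^^ k) u \<in> lp p" for k
    using lp_weight_two[OF p] u unfolding lp_weight_def lp_bounded_def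
    by (induction k) auto
  have "lower_density {k. (backward_shift (\<lambda>_. 2) ^^ k) u \<in> U} > 0"
    if U: "openin (lp_topology p) U" "U \<noteq> {}" for U
  proof -
    obtain t where t: "t \<in> U" using U by blast
    with U(1) obtain \<epsilon> where \<epsilon>: "\<epsilon> > 0" "\<And>y. y \<in> lp p \<Longrightarrow> lp_dist p t y < \<epsilon> \<Longrightarrow> y \<in> U"
      and t_lp: "t \<in> lp p"
      unfolding openin_lp_topology[OF p] by blast
    define G where "G n = norm (t n) + g n" for n
    have G: "G \<in> lp p"
      unfolding G_def using g t_lp by (intro lp_minkowski(1)[OF p]) (simp_all add: lp_def)
    have G_norm: "\<bar>G n\<bar> = norm (t n) + real n / 2 ^ n" for n
      by (simp add: G_def g_def)
    have eps2: "\<epsilon> powr p / 2 > 0" using \<epsilon> by simp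
    have "summable (\<lambda>n. norm (G n) powr p)" using G by (simp add: lp_def)
    from suminf_exist_split[OF eps2 this]
    obtain N where "norm (\<Sum>n. norm (G (n + N)) powr p) < \<epsilon> powr p / 2" by blast
    then have N: "(\<Sum>n. norm (G (n + N)) powr p) < \<epsilon> powr p / 2" by simp
    \<comment> \<open>Chosen so that \<open>N + 1\<close> coordinates of size \<open>\<delta>\<close> use up half of \<open>\<epsilon>\<^sup>p\<close>.\<close>
    define \<delta> where "\<delta> = (\<epsilon> powr p / 2 / Suc N) powr (1 / p)"
    have \<delta>: "\<delta> > 0" using \<epsilon> by (simp add: \<delta>_def)
    have "real (Suc N) * \<delta> powr p = \<epsilon> powr p / 2"
      using p by (simp add: \<delta>_def powr_powr del: of_nat_Suc)
    then have "real N * \<delta> powr p + \<delta> powr p = \<epsilon> powr p / 2"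
      by (simp add: distrib_right)
    moreover have "\<delta> powr p > 0" using \<delta> by simp
    ultimately have N\<delta>: "real N * \<delta> powr p < \<epsilon> powr p / 2" by linarith
    have "\<forall>n. \<exists>i. norm (d i - 2 ^ n * t n) < \<delta>" using dense[OF \<delta>] by blast
    from choice[OF this] obtain i where i: "\<And>n. norm (d (i n) - 2 ^ n * t n) < \<delta>" by blast
    from word_realizes[of N d i] obtain j where j: "N \<le> j"
      "\<And>n. n < N \<Longrightarrow> word d j n = d (i n)" "\<And>n. n \<ge> N \<Longrightarrow> word d j n = 0"
      by blast
    show ?thesis
    proof (rule lower_density_content_starts)
      fix m assume m: "ruler m = j"
      define k where "k = block_start m + Suc j"
      let ?y = "(backward_shift (\<lambda>_. 2) ^^ k) u"
      have content: "v (k + n) = word d j n" if "n \<le> j" for n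
        using block_seq_content[of n m "word d"] that m by (simp add: v_def k_def)
      have "lp_dist p t ?y < \<epsilon>"
        unfolding lp_dist_def
      proof (rule lp_norm_less_split[OF p _ G \<epsilon>(1) _ N\<delta> _ N])
        show "(\<lambda>n. t n - ?y n) \<in> lp p" by (rule lp_diff[OF p t_lp orbit_lp])
        show "norm (t n - ?y n) \<le> \<delta>" if n: "n < N" for n
        proof -
          have "?y n = d (i n) / 2 ^ n"
            using n j(1) j(2)[OF n] content[of n] by (simp add: orbit)
          then have "t n - ?y n = - ((d (i n) - 2 ^ n * t n) / 2 ^ n)"
            by (simp only: diff_divide_distrib minus_diff_eq) simp
          then have "norm (t n - ?y n) = norm (d (i n) - 2 ^ n * t n) / 2 ^ n"
            by (simp only: norm_minus_cancel norm_divide norm_power norm_numeral)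
          also have "\<dots> \<le> norm (d (i n) - 2 ^ n * t n)"
            by (simp add: divide_le_eq mult_le_cancel_left1)
          finally show ?thesis using i[of n] by simp
        qed
        show "norm (t n - ?y n) \<le> norm (G n)" if n: "n \<ge> N" for n
        proof (cases "n \<le> j")
          \<comment> \<open>Still inside the block, but beyond the \<open>N\<close> letters of its word.\<close>
          case True
          then have "?y n = 0" using content[of n] j(3)[OF n] by (simp add: orbit)
          then show ?thesis by (simp add: G_norm)
        next
          case False
          then have "norm (v (k + n)) \<le> n"
            using norm_block_seq_after_content[of "word d" m n, OF norm_word_le] m
            by (simp add: v_def k_def)
          then have "norm (?y n) \<le> n / 2 ^ n"
            by (simp add: orbit norm_divide norm_power divide_right_mono)
          then show ?thesis
            using norm_triangle_ineq4[of "t n" "?y n"] by (simp add: G_norm)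
        qed
      qed
      then have "?y \<in> U" by (rule \<epsilon>(2)[OF orbit_lp])
      then show "block_start m + Suc j \<in> {k. (backward_shift (\<lambda>_. 2) ^^ k) u \<in> U}"
        unfolding k_def mem_Collect_eq .
    qed
  qed
  then have "u \<in> FHC (lp_topology p) (backward_shift (\<lambda>_. 2))"
    using u by (simp add: FHC_def topspace_lp_topology[OF p])
  then show ?thesis by (auto simp: frequently_hypercyclic_def)
qed

(* The scalar field 'a: the multiplicative norm of real_normed_field together with
   finite-dimensionality over the reals leaves exactly the real and the complex field. *)
theorem proposition4p8:
  fixes p :: real
  assumes "1 \<le> p"
  shows "\<exists>w w' :: nat \<Rightarrow> 'a::{real_normed_field, euclidean_space}.
    lp_weight p w \<and> lp_weight p w' \<and>
    frequently_hypercyclic (lp_topology p) (backward_shift w) \<and>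
    frequently_hypercyclic (lp_topology p) (backward_shift w') \<and>
    (\<exists>l l'. l \<noteq> l' \<and> l \<noteq> 0 \<and> l' \<noteq> 0 \<and>
      seq_limit_point (\<lambda>n. (\<Prod>k=1..n. w k) / (\<Prod>k=1..n. w' k)) l \<and>
      seq_limit_point (\<lambda>n. (\<Prod>k=1..n. w k) / (\<Prod>k=1..n. w' k)) l') \<and>
    FHC (lp_topology p) (backward_shift w) \<noteq> FHC (lp_topology p) (backward_shift w')"
proof -
  let ?w = "\<lambda>_::nat. 2 :: 'a"
  note w = lp_weight_two[OF assms, where 'a = 'a]
  note fhc = frequently_hypercyclic_doubled_shift[OF assms, where 'a = 'a]
  show ?thesis
    by (rule exI[of _ ?w], rule ex_forward[OF frequently_hypercyclic_sign_change[OF assms w fhc]])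
      (elim conjE, intro conjI w fhc; assumption)
qed

end
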